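(* Let $\theta\in[0,1)$ and let $u^0\in V$ be a deterministic initial guess. Consider the fault-tolerant randomized successive subspace correction method: at each iteration $k\ge0$, with probability $\theta$ an error occurs and then $u^{k+1}=u^k$; otherwise (with probability $1-\theta$) an index $i\in\{1,\dots,J\}$ is drawn uniformly (probability $\frac1J$) and $$u^{k+1}=u^k+R_iQ_i(f-Au^k).$$ Assume that the probability $\theta$ of an error is independent of $k$, and that the occurrence of errors is independent of how $i$ is picked (and the draws at different iterations are independent). Put $e^k=u-u^k$, where $u$ is the solution of $Au=f$. Then the method converges with the expected convergence rate, for all $k\ge0$, $$E(\|u-u^{k+1}\|_A^2)=\Big(1-\frac{(1-\theta)\delta_k}{J}\Big)E(\|u-u^k\|_A^2)=\prod_{\ell=0}^{k}\Big(1-\frac{(1-\theta)\delta_\ell}{J}\Big)\|u-u^0\|_A^2,$$ where $$\delta_k=\frac{E\big((B_aAe^k,e^k)_A\big)}{E\big((e^k,e^k)_A\big)}>0 .$$ Moreover, if $\|I-T_i\|_A<1$ for $i=1,\dots,J$, then $\delta_k<J$.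
   Context: $V$ is a Hilbert space with inner product $(\cdot,\cdot)$, $A:V\to V$ is a symmetric positive definite linear operator, $(v,w)_A=(Av,w)$ and $\|v\|_A^2=(v,v)_A$. Given $f\in V$, $u\in V$ denotes the solution of $Au=f$. The space is decomposed as $V=\sum_{i=1}^J V_i$ with subspaces $V_i\subset V$ (the sum need not be direct). For each $i$, the operators $Q_i,P_i:V\to V_i$ and $A_i:V_i\to V_i$ are defined by $(Q_iv,v_i)=(v,v_i)$, $(P_iv,v_i)_A=(v,v_i)_A$ for all $v\in V$, $v_i\in V_i$, and $(A_iw_i,v_i)=(Aw_i,v_i)$ for all $w_i,v_i\in V_i$. $I_i:V_i\to V$ is the natural inclusion. $R_i:V_i\to V_i$ is a given nonsingular linear operator (an approximation of $A_i^{-1}$), and $R_i^t$ is its adjoint with respect to $(\cdot,\cdot)$. Define $T_i=R_iQ_iA=R_iA_iP_i$. The condition $\|I-T_i\|_A<1$ refers to $T_i$ as an operator $V_i\to V_i$, i.e. the operator norm induced by $\|\cdot\|_A$ on $V_i$. Define $\bar R_i=R_i^t+R_i-R_i^tA_iR_i$ and the (parallel subspace correction) operator $B_a=\sum_{i=1}^J I_i\bar R_iQ_i$. $E$ denotes expectation over the random error occurrences and index choices. The quotients $\delta_k$ presuppose $E(\|e^k\|_A^2)\neq0$.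
   Formalization: δ_k>0 is stated only under ‖I−T_i‖_A<1 for all i (it fails for V=ℝ, A=1, J=1, R_1=3); δ_k<J is replaced by δ_k≤J, with δ_k<J exactly when not all T_i e^k=e^k almost surely (it fails for J=1, R_1=A^{-1}). *)

theory Defs
  imports "HOL-Probability.Probability"
begin

definition spd_operator :: "('v::real_inner \<Rightarrow> 'v) \<Rightarrow> bool" where
  "spd_operator A \<longleftrightarrow> linear A \<and> (\<forall>v w. A v \<bullet> w = v \<bullet> A w) \<and> (\<forall>v. v \<noteq> 0 \<longrightarrow> 0 < A v \<bullet> v)"

definition energy_inner :: "('v::real_inner \<Rightarrow> 'v) \<Rightarrow> 'v \<Rightarrow> 'v \<Rightarrow> real" where
  "energy_inner A v w = A v \<bullet> w"

definition energy_norm :: "('v::real_inner \<Rightarrow> 'v) \<Rightarrow> 'v \<Rightarrow> real" where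
  "energy_norm A v = sqrt (energy_inner A v v)"

text \<open>Operator norm of \<open>F : S \<rightarrow> S\<close> induced by the energy norm.  The supremum is taken in
  \<^typ>\<open>ennreal\<close>, so that it is \<open>0\<close> on the trivial subspace and \<open>\<infinity>\<close> for unbounded operators.\<close>

definition energy_opnorm :: "('v::real_inner \<Rightarrow> 'v) \<Rightarrow> 'v set \<Rightarrow> ('v \<Rightarrow> 'v) \<Rightarrow> ennreal" where
  "energy_opnorm A S F = (SUP v\<in>S - {0}. ennreal (energy_norm A (F v) / energy_norm A v))"

text \<open>Operators \<open>S \<rightarrow> S\<close> on a subspace \<open>S\<close> are represented by functions on the whole space of
  which only the values on \<open>S\<close> matter; the inclusion of \<open>S\<close> is therefore implicit.\<close>

definition linear_operator_on :: "'v::real_vector set \<Rightarrow> ('v \<Rightarrow> 'v) \<Rightarrow> bool" where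
  "linear_operator_on S F \<longleftrightarrow> F ` S \<subseteq> S \<and> (\<forall>v\<in>S. \<forall>w\<in>S. F (v + w) = F v + F w) \<and>
     (\<forall>c. \<forall>v\<in>S. F (c *\<^sub>R v) = c *\<^sub>R F v)"

definition nonsingular_operator_on :: "'v::real_vector set \<Rightarrow> ('v \<Rightarrow> 'v) \<Rightarrow> bool" where
  "nonsingular_operator_on S F \<longleftrightarrow> linear_operator_on S F \<and> bij_betw F S S"

definition adjoint_operator_on :: "'v::real_inner set \<Rightarrow> ('v \<Rightarrow> 'v) \<Rightarrow> ('v \<Rightarrow> 'v) \<Rightarrow> bool" where
  "adjoint_operator_on S F G \<longleftrightarrow> G ` S \<subseteq> S \<and> (\<forall>v\<in>S. \<forall>w\<in>S. G v \<bullet> w = v \<bullet> F w)"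

text \<open>Projection onto \<open>S\<close> that is orthogonal with respect to the inner product \<open>ip\<close>.\<close>

definition projection_operator_on ::
    "('v \<Rightarrow> 'v \<Rightarrow> real) \<Rightarrow> 'v set \<Rightarrow> ('v \<Rightarrow> 'v) \<Rightarrow> bool" where
  "projection_operator_on ip S F \<longleftrightarrow> (\<forall>v. F v \<in> S \<and> (\<forall>w\<in>S. ip (F v) w = ip v w))"

text \<open>The operator \<open>A\<^sub>S : S \<rightarrow> S\<close> with \<open>(A\<^sub>S w, v) = (A w, v)\<close>.\<close>

definition restricted_operator_on ::
    "('v::real_inner \<Rightarrow> 'v) \<Rightarrow> 'v set \<Rightarrow> ('v \<Rightarrow> 'v) \<Rightarrow> bool" where
  "restricted_operator_on A S F \<longleftrightarrow> F ` S \<subseteq> S \<and> (\<forall>w\<in>S. \<forall>v\<in>S. F w \<bullet> v = A w \<bullet> v)"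

text \<open>The families of operators below are used only for the indices \<open>1, \<dots>, J\<close>.\<close>

definition subspace_solver ::
    "('v \<Rightarrow> 'v) \<Rightarrow> (nat \<Rightarrow> 'v \<Rightarrow> 'v) \<Rightarrow> (nat \<Rightarrow> 'v \<Rightarrow> 'v) \<Rightarrow> nat \<Rightarrow> 'v \<Rightarrow> 'v" where
  "subspace_solver A Q R i v = R i (Q i (A v))"

definition symmetrized_solver :: "(nat \<Rightarrow> 'v::real_vector \<Rightarrow> 'v) \<Rightarrow> (nat \<Rightarrow> 'v \<Rightarrow> 'v)
    \<Rightarrow> (nat \<Rightarrow> 'v \<Rightarrow> 'v) \<Rightarrow> nat \<Rightarrow> 'v \<Rightarrow> 'v" where
  "symmetrized_solver As R Rt i w = Rt i w + R i w - Rt i (As i (R i w))"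

definition parallel_correction :: "nat \<Rightarrow> (nat \<Rightarrow> 'v::real_vector \<Rightarrow> 'v) \<Rightarrow> (nat \<Rightarrow> 'v \<Rightarrow> 'v)
    \<Rightarrow> (nat \<Rightarrow> 'v \<Rightarrow> 'v) \<Rightarrow> (nat \<Rightarrow> 'v \<Rightarrow> 'v) \<Rightarrow> 'v \<Rightarrow> 'v" where
  "parallel_correction J As Q R Rt v = (\<Sum>i=1..J. symmetrized_solver As R Rt i (Q i v))"

text \<open>\<open>err k \<omega>\<close> says that an error occurs in iteration \<open>k\<close>.  The index \<open>idx k \<omega>\<close> is drawn
  in every iteration and ignored if an error occurs; as it is independent of \<open>err k\<close>, this is
  the same as drawing it only in the absence of an error.\<close>

primrec fault_tolerant_iterate :: "('v::real_vector \<Rightarrow> 'v) \<Rightarrow> (nat \<Rightarrow> 'v \<Rightarrow> 'v) \<Rightarrow>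
    (nat \<Rightarrow> 'v \<Rightarrow> 'v) \<Rightarrow> 'v \<Rightarrow> 'v \<Rightarrow> (nat \<Rightarrow> 'w \<Rightarrow> bool) \<Rightarrow> (nat \<Rightarrow> 'w \<Rightarrow> nat) \<Rightarrow> nat \<Rightarrow> 'w \<Rightarrow> 'v" where
  "fault_tolerant_iterate A Q R f u0 err idx 0 \<omega> = u0"
| "fault_tolerant_iterate A Q R f u0 err idx (Suc k) \<omega> =
     (let v = fault_tolerant_iterate A Q R f u0 err idx k \<omega>; i = idx k \<omega>
      in if err k \<omega> then v else v + R i (Q i (f - A v)))"

text \<open>All the \<open>err k\<close> and \<open>idx k\<close> are mutually independent; the errors are encoded as
  elements of \<open>{0, 1}\<close> since an independent family must share one codomain type.\<close>

definition error_index_process ::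
    "'w measure \<Rightarrow> nat \<Rightarrow> real \<Rightarrow> (nat \<Rightarrow> 'w \<Rightarrow> bool) \<Rightarrow> (nat \<Rightarrow> 'w \<Rightarrow> nat) \<Rightarrow> bool" where
  "error_index_process M J \<theta> err idx \<longleftrightarrow>
     prob_space M \<and>
     (\<forall>k. err k \<in> measurable M (count_space UNIV)) \<and>
     (\<forall>k. idx k \<in> measurable M (count_space UNIV)) \<and>
     (\<forall>k. measure M {\<omega> \<in> space M. err k \<omega>} = \<theta>) \<and>
     (\<forall>k. \<forall>i\<in>{1..J}. measure M {\<omega> \<in> space M. idx k \<omega> = i} = 1 / real J) \<and>
     prob_space.indep_vars M (\<lambda>_. count_space UNIV)
       (case_sum (\<lambda>k \<omega>. of_bool (err k \<omega>)) idx) (UNIV :: (nat + nat) set)"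

end

theory Submission
  imports Defs
begin

text \<open>Writing \<open>T\<^sub>i v = R\<^sub>i Q\<^sub>i A v\<close>, the symmetrization \<open>S\<^sub>i = R\<^sub>i\<^sup>t + R\<^sub>i - R\<^sub>i\<^sup>t A\<^sub>i R\<^sub>i\<close> is what makes
  \<open>(S\<^sub>i Q\<^sub>i A v, v)\<^sub>A = \<parallel>v\<parallel>\<^sub>A\<^sup>2 - \<parallel>v - T\<^sub>i v\<parallel>\<^sub>A\<^sup>2\<close>.  Averaging over the draw of step \<open>k\<close>, which is
  independent of \<open>e\<^sup>k\<close>, turns the sum of these identities over \<open>i\<close> into the recursion for the expected
  energy error.  For the positivity of \<open>\<delta>\<^sub>k\<close>, the vector \<open>v - P\<^sub>i v\<close> is \<open>A\<close>-orthogonal to \<open>V\<^sub>i\<close> and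
  \<open>T\<^sub>i v = T\<^sub>i P\<^sub>i v\<close>, so each of the differences above equals
  \<open>\<parallel>P\<^sub>i v\<parallel>\<^sub>A\<^sup>2 - \<parallel>(I - T\<^sub>i) P\<^sub>i v\<parallel>\<^sub>A\<^sup>2\<close>, which the contraction
  property makes positive unless \<open>P\<^sub>i v = 0\<close>; and if all \<open>P\<^sub>i v\<close> vanish
  then \<open>v = 0\<close> because the subspaces span the space.\<close>

section \<open>Energy estimates for a single subspace correction\<close>

lemma energy_inner_commute:
  assumes "spd_operator A"
  shows "energy_inner A v w = energy_inner A w v"
  using assms unfolding spd_operator_def energy_inner_def by (metis inner_commute)

lemma energy_inner_self_nonneg:
  assumes "spd_operator A"
  shows "0 \<le> energy_inner A v v"
  using assms by (cases "v = 0") (auto simp: spd_operator_def energy_inner_def intro: less_imp_le)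

lemma energy_norm_power2:
  assumes "spd_operator A"
  shows "(energy_norm A v)\<^sup>2 = energy_inner A v v"
  using energy_inner_self_nonneg[OF assms] by (simp add: energy_norm_def)

lemma energy_norm_nonneg:
  assumes "spd_operator A"
  shows "0 \<le> energy_norm A v"
  using energy_inner_self_nonneg[OF assms] by (simp add: energy_norm_def)

lemma energy_norm_eq_0_iff:
  assumes "spd_operator A"
  shows "energy_norm A v = 0 \<longleftrightarrow> v = 0"
  using assms by (auto simp: spd_operator_def energy_inner_def energy_norm_def less_le)

lemma energy_norm_add_power2:
  assumes "spd_operator A"
  shows "(energy_norm A (v + w))\<^sup>2
    = (energy_norm A v)\<^sup>2 + 2 * energy_inner A v w + (energy_norm A w)\<^sup>2"
proof -
  have "linear A"
    using assms by (simp add: spd_operator_def)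
  then show ?thesis
    using energy_inner_commute[OF assms, of v w]
    by (simp add: energy_norm_power2[OF assms])
       (simp add: energy_inner_def linear_add inner_add)
qed

lemma energy_norm_diff_power2:
  assumes "spd_operator A"
  shows "(energy_norm A (v - w))\<^sup>2
    = (energy_norm A v)\<^sup>2 - 2 * energy_inner A w v + (energy_norm A w)\<^sup>2"
proof -
  have "linear A"
    using assms by (simp add: spd_operator_def)
  then show ?thesis
    using energy_inner_commute[OF assms, of v w]
    by (simp add: energy_norm_power2[OF assms])
       (simp add: energy_inner_def linear_diff inner_diff)
qed

section \<open>Effect of one subspace correction on the energy norm\<close>

text \<open>For \<open>x\<close> in \<open>S\<close>, pairing with \<open>v\<close> in the energy
  inner product is the plain pairing with \<open>w = Q i (A v)\<close>. Both adjoint terms can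
  therefore be moved onto \<open>R i w\<close>: the first becomes a second copy of
  \<open>energy_inner A (R i w) v\<close>, the other the squared energy norm of
  \<open>R i w\<close>. This is the binomial expansion of the right-hand side, since
  \<open>R i w\<close> is the correction itself.\<close>

lemma energy_inner_symmetrized_solver:
  assumes A: "spd_operator A"
    and Q: "projection_operator_on (\<bullet>) S (Q i)"
    and As: "restricted_operator_on A S (As i)"
    and R: "R i ` S \<subseteq> S"
    and Rt: "adjoint_operator_on S (R i) (Rt i)"
  shows "energy_inner A (symmetrized_solver As R Rt i (Q i (A v))) v
    = (energy_norm A v)\<^sup>2 - (energy_norm A (v - subspace_solver A Q R i v))\<^sup>2"
proof -
  define w where "w = Q i (A v)"
  have w: "w \<in> S" and Rw: "R i w \<in> S" and AsRw: "As i (R i w) \<in> S"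
    using Q R As unfolding w_def projection_operator_on_def restricted_operator_on_def by blast+
  have "Rt i (As i (R i w)) \<in> S" "Rt i w \<in> S"
    using Rt w AsRw by (auto simp: adjoint_operator_on_def)
  have test: "energy_inner A x v = x \<bullet> w" if "x \<in> S" for x
    using A Q that unfolding w_def energy_inner_def spd_operator_def projection_operator_on_def
    by (metis inner_commute)
  have Rt': "Rt i x \<bullet> y = x \<bullet> R i y" if "x \<in> S" "y \<in> S" for x y
    using Rt that by (simp add: adjoint_operator_on_def)
  have lin: "linear A"
    using A by (simp add: spd_operator_def)
  have "energy_inner A (symmetrized_solver As R Rt i w) v
      = energy_inner A (Rt i w) v + energy_inner A (R i w) v - energy_inner A (Rt i (As i (R i w))) v"
    by (simp add: symmetrized_solver_def energy_inner_def linear_add[OF lin] linear_diff[OF lin]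
        inner_add_left inner_diff_left)
  also have "\<dots> = 2 * energy_inner A (R i w) v - As i (R i w) \<bullet> R i w"
    using \<open>Rt i w \<in> S\<close> \<open>Rt i (As i (R i w)) \<in> S\<close> Rw AsRw w
    by (simp add: test Rt') (simp add: inner_commute)
  also have "As i (R i w) \<bullet> R i w = (energy_norm A (R i w))\<^sup>2"
    using As Rw by (simp add: energy_norm_power2[OF A] energy_inner_def restricted_operator_on_def)
  finally show ?thesis
    by (simp add: energy_norm_diff_power2[OF A] subspace_solver_def w_def)
qed

text \<open>\<open>Q i (A v)\<close> is determined by the pairings of \<open>A v\<close> with
  elements of \<open>S\<close>, and these are exactly the energy pairings that \<open>P i\<close>
  preserves. The inputs handed to \<open>R i\<close> thus coincide already.\<close>

lemma subspace_solver_energy_projection: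
  assumes S: "subspace S"
    and Q: "projection_operator_on (\<bullet>) S (Q i)"
    and P: "projection_operator_on (energy_inner A) S (P i)"
  shows "subspace_solver A Q R i (P i v) = subspace_solver A Q R i v"
proof -
  \<comment> \<open>The difference lies in \<open>S\<close>, so it can serve as its own test
    vector.\<close>
  let ?d = "Q i (A v) - Q i (A (P i v))"
  have "?d \<in> S"
    using Q S by (simp add: projection_operator_on_def subspace_diff)
  then have "Q i (A v) \<bullet> ?d = A v \<bullet> ?d" "Q i (A (P i v)) \<bullet> ?d = A v \<bullet> ?d"
    using Q P by (simp_all only: projection_operator_on_def energy_inner_def)
  then have "?d \<bullet> ?d = 0"
    unfolding inner_diff_left[of "Q i (A v)"] by linarith
  then show ?thesis
    by (simp add: subspace_solver_def)
qed

lemma energy_norm_less_if_opnorm_less_1: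
  assumes A: "spd_operator A" and F: "energy_opnorm A S F < 1" and v: "v \<in> S" "v \<noteq> 0"
  shows "energy_norm A (F v) < energy_norm A v"
proof -
  have "ennreal (energy_norm A (F v) / energy_norm A v) \<le> energy_opnorm A S F"
    unfolding energy_opnorm_def using v by (intro SUP_upper) auto
  with F have "energy_norm A (F v) / energy_norm A v < 1"
    by (metis ennreal_less_one_iff order.strict_trans1)
  moreover have "0 < energy_norm A v"
    using energy_norm_nonneg[OF A, of v] energy_norm_eq_0_iff[OF A, of v] v by linarith
  ultimately show ?thesis
    by simp
qed

lemma energy_norm_subspace_correction_less:
  assumes A: "spd_operator A"
    and S: "subspace S"
    and Q: "projection_operator_on (\<bullet>) S (Q i)"
    and P: "projection_operator_on (energy_inner A) S (P i)"
    and R: "R i ` S \<subseteq> S"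
    and contraction: "energy_opnorm A S (\<lambda>v. v - subspace_solver A Q R i v) < 1"
    and Pv: "P i v \<noteq> 0"
  shows "(energy_norm A (v - subspace_solver A Q R i v))\<^sup>2 < (energy_norm A v)\<^sup>2"
proof -
  let ?T = "subspace_solver A Q R i"
  have PS: "P i v \<in> S"
    using P by (simp add: projection_operator_on_def)
  have "?T v \<in> S"
    using Q R by (auto simp: subspace_solver_def projection_operator_on_def)
  then have dS: "P i v - ?T v \<in> S"
    using S PS by (simp add: subspace_diff)
  have lin: "linear A"
    using A by (simp add: spd_operator_def)
  have orth: "energy_inner A (v - P i v) w = 0" if "w \<in> S" for w
    using P that
    by (simp add: energy_inner_def projection_operator_on_def linear_diff[OF lin] inner_diff_left)
  \<comment> \<open>Pythagoras for \<open>v\<close> and for \<open>v - ?T v\<close>: both have the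
    same component \<open>v - P i v\<close> orthogonal to \<open>S\<close>, which cancels in the
    comparison and leaves only vectors of \<open>S\<close>, where the contraction applies.\<close>
  have "(energy_norm A (v - ?T v))\<^sup>2
      = (energy_norm A (v - P i v))\<^sup>2 + (energy_norm A (P i v - ?T v))\<^sup>2"
    using energy_norm_add_power2[OF A, of "v - P i v" "P i v - ?T v"] orth[OF dS] by simp
  moreover have "(energy_norm A v)\<^sup>2 = (energy_norm A (v - P i v))\<^sup>2 + (energy_norm A (P i v))\<^sup>2"
    using energy_norm_add_power2[OF A, of "v - P i v" "P i v"] orth[OF PS] by simp
  moreover have "energy_norm A (P i v - ?T v) < energy_norm A (P i v)"
    using energy_norm_less_if_opnorm_less_1[OF A contraction PS Pv]
    by (simp add: subspace_solver_energy_projection[where Q=Q and P=P, OF S Q P])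
  then have "(energy_norm A (P i v - ?T v))\<^sup>2 < (energy_norm A (P i v))\<^sup>2"
    using energy_norm_nonneg[OF A] by (simp add: power_strict_mono)
  ultimately show ?thesis
    by simp
qed

lemma energy_norm_subspace_correction_le:
  assumes A: "spd_operator A"
    and S: "subspace S"
    and Q: "projection_operator_on (\<bullet>) S (Q i)"
    and P: "projection_operator_on (energy_inner A) S (P i)"
    and R: "linear_operator_on S (R i)"
    and contraction: "energy_opnorm A S (\<lambda>v. v - subspace_solver A Q R i v) < 1"
  shows "(energy_norm A (v - subspace_solver A Q R i v))\<^sup>2 \<le> (energy_norm A v)\<^sup>2"
proof (cases "P i v = 0")
  case True
  have lin: "linear A"
    using A by (simp add: spd_operator_def)
  \<comment> \<open>The correction of \<open>v\<close> equals that of \<open>P i v = 0\<close>. It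
    vanishes: \<open>Q i 0\<close> lies in \<open>S\<close> and is orthogonal to \<open>S\<close>,
    hence to itself, and \<open>R i\<close> is homogeneous.\<close>
  have "Q i 0 \<bullet> Q i 0 = 0"
    using Q by (metis projection_operator_on_def inner_zero_left)
  moreover have "R i 0 = 0"
    using R subspace_0[OF S] unfolding linear_operator_on_def by (metis scaleR_zero_left)
  ultimately have "subspace_solver A Q R i (P i v) = 0"
    by (simp add: True subspace_solver_def linear_0[OF lin])
  then show ?thesis
    by (simp add: subspace_solver_energy_projection[where Q=Q and P=P, OF S Q P])
next
  case False
  have "R i ` S \<subseteq> S"
    using R by (simp add: linear_operator_on_def)
  from energy_norm_subspace_correction_less[where P=P and Q=Q and i=i, OF A S Q P this contraction False]
  show ?thesis
    by simp
qed

text \<open>Pair \<open>v\<close> with its own decomposition: each \<open>A v \<bullet> w i\<close>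
  equals \<open>A (P i v) \<bullet> w i = 0\<close>, so \<open>A v \<bullet> v = 0\<close> and
  definiteness applies.\<close>

lemma energy_projections_eq_0:
  assumes A: "spd_operator A"
    and decomposition: "\<exists>w. (\<forall>i\<in>I. w i \<in> V i) \<and> v = (\<Sum>i\<in>I. w i)"
    and P: "\<And>i. i \<in> I \<Longrightarrow> projection_operator_on (energy_inner A) (V i) (P i)"
    and Pv: "\<And>i. i \<in> I \<Longrightarrow> P i v = 0"
  shows "v = 0"
proof -
  have lin: "linear A"
    using A by (simp add: spd_operator_def)
  obtain w where w: "\<And>i. i \<in> I \<Longrightarrow> w i \<in> V i" and v: "v = (\<Sum>i\<in>I. w i)"
    using decomposition by blast
  have "A v \<bullet> w i = 0" if "i \<in> I" for i
  proof -
    have "A v \<bullet> w i = A (P i v) \<bullet> w i"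
      using P[OF that] w[OF that] by (simp add: projection_operator_on_def energy_inner_def)
    then show ?thesis
      by (simp add: Pv[OF that] linear_0[OF lin])
  qed
  then have "A v \<bullet> v = 0"
    by (subst (2) v) (simp add: inner_sum_right)
  then show ?thesis
    using A by (metis spd_operator_def less_irrefl)
qed

section \<open>Expectations along the iteration\<close>

text \<open>Iterate \<open>k\<close> sees only the draws before step \<open>k\<close>. The two
  processes may live on different sample spaces, which later allows the iteration to be run on the
  product space of draws.\<close>

lemma fault_tolerant_iterate_cong:
  assumes "\<And>j. j < k \<Longrightarrow> err j \<omega> = err' j \<omega>'" "\<And>j. j < k \<Longrightarrow> idx j \<omega> = idx' j \<omega>'"
  shows "fault_tolerant_iterate A Q R f u0 err idx k \<omega> = fault_tolerant_iterate A Q R f u0 err' idx' k \<omega>'"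
  using assms by (induction k) (simp_all add: Let_def)

text \<open>The vector space carries the discrete sigma-algebra, so every map out of it is
  measurable. Error bits and indices take countably many values, so it suffices to treat each fixed
  bit and index and to glue the results.\<close>

lemma measurable_fault_tolerant_iterate:
  assumes "\<And>j. j < k \<Longrightarrow> err j \<in> measurable M (count_space UNIV)"
    and "\<And>j. j < k \<Longrightarrow> idx j \<in> measurable M (count_space UNIV)"
  shows "fault_tolerant_iterate A Q R f u0 err idx k \<in> measurable M (count_space UNIV)"
  using assms
proof (induction k)
  case 0
  show ?case by simp
next
  case (Suc k)
  let ?W = "fault_tolerant_iterate A Q R f u0 err idx k"
  have W: "?W \<in> measurable M (count_space UNIV)"
    using Suc by simp
  let ?F = "\<lambda>i b v. if b then v else v + R i (Q i (f - A v))"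
  have "(\<lambda>\<omega>. ?F i b (?W \<omega>)) \<in> measurable M (count_space UNIV)" for i b
    by (rule measurable_compose[OF W, where g="?F i b"]) simp
  then have "(\<lambda>\<omega>. ?F i (err k \<omega>) (?W \<omega>)) \<in> measurable M (count_space UNIV)" for i
    by (rule measurable_compose_countable[where f="\<lambda>b \<omega>. ?F i b (?W \<omega>)" and g="err k"])
       (simp add: Suc.prems)
  then have "(\<lambda>\<omega>. ?F (idx k \<omega>) (err k \<omega>) (?W \<omega>)) \<in> measurable M (count_space UNIV)"
    by (rule measurable_compose_countable[where f="\<lambda>i \<omega>. ?F i (err k \<omega>) (?W \<omega>)" and g="idx k"])
       (simp add: Suc.prems)
  then show ?case
    by (simp add: Let_def)
qed

text \<open>The \<open>J\<close> disjoint events of probability \<open>1 / real J\<close> already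
  exhaust the total mass, so indices at which the operators are unspecified occur with probability
  0.\<close>

lemma AE_index_in_range:
  assumes process: "error_index_process M J \<theta> err idx" and J: "1 \<le> J"
  shows "AE \<omega> in M. idx k \<omega> \<in> {1..J}"
proof -
  interpret prob_space M
    using process by (simp add: error_index_process_def)
  have [measurable]: "idx k \<in> measurable M (count_space UNIV)"
    using process by (simp add: error_index_process_def)
  have "prob (\<Union>i\<in>{1..J}. {\<omega> \<in> space M. idx k \<omega> = i}) = (\<Sum>i\<in>{1..J}. prob {\<omega> \<in> space M. idx k \<omega> = i})"
    by (rule finite_measure_finite_Union) (auto simp: disjoint_family_on_def)
  also have "\<dots> = 1"
    using process J by (simp add: error_index_process_def)
  finally have "AE \<omega> in M. \<omega> \<in> (\<Union>i\<in>{1..J}. {\<omega> \<in> space M. idx k \<omega> = i})"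
    by (rule AE_prob_1)
  then show ?thesis
    by eventually_elim auto
qed

text \<open>Each step either keeps the vector or applies one of \<open>J\<close> corrections, so the
  tree of possible iterates is finitely branching. Any real function of an iterate is then almost
  surely bounded.\<close>

lemma AE_fault_tolerant_iterate_finite:
  assumes process: "error_index_process M J \<theta> err idx" and J: "1 \<le> J"
  shows "\<exists>S. finite S \<and> (AE \<omega> in M. fault_tolerant_iterate A Q R f u0 err idx k \<omega> \<in> S)"
proof (induction k)
  case 0
  show ?case by (intro exI[of _ "{u0}"]) simp
next
  case (Suc k)
  then obtain S where S: "finite S" and AE: "AE \<omega> in M. fault_tolerant_iterate A Q R f u0 err idx k \<omega> \<in> S"
    by blast
  let ?S' = "S \<union> (\<Union>i\<in>{1..J}. (\<lambda>v. v + R i (Q i (f - A v))) ` S)"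
  have "AE \<omega> in M. fault_tolerant_iterate A Q R f u0 err idx (Suc k) \<omega> \<in> ?S'"
    using AE AE_index_in_range[OF process J, of k] by eventually_elim (auto simp: Let_def)
  with S show ?case
    by (intro exI[of _ ?S']) auto
qed

lemma integrable_fault_tolerant_iterate:
  fixes g :: "'v::real_vector \<Rightarrow> real"
  assumes process: "error_index_process M J \<theta> err idx" and J: "1 \<le> J"
  shows "integrable M (\<lambda>\<omega>. g (fault_tolerant_iterate A Q R f u0 err idx k \<omega>))"
proof -
  interpret prob_space M
    using process by (simp add: error_index_process_def)
  let ?W = "fault_tolerant_iterate A Q R f u0 err idx k"
  have "?W \<in> measurable M (count_space UNIV)"
    using process by (intro measurable_fault_tolerant_iterate) (simp_all add: error_index_process_def)
  then have "(\<lambda>\<omega>. g (?W \<omega>)) \<in> borel_measurable M"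
    by (rule measurable_compose) simp
  moreover obtain S where S: "finite S" and AE: "AE \<omega> in M. ?W \<omega> \<in> S"
    using AE_fault_tolerant_iterate_finite[OF process J, where k=k] by blast
  have "norm (g v) \<le> (\<Sum>v\<in>S. \<bar>g v\<bar>)" if "v \<in> S" for v
    using member_le_sum[of v S "\<lambda>v. \<bar>g v\<bar>"] S that by simp
  then have "AE \<omega> in M. norm (g (?W \<omega>)) \<le> (\<Sum>v\<in>S. \<bar>g v\<bar>)"
    using AE by (rule eventually_mono[rotated])
  ultimately show ?thesis
    by (intro integrable_const_bound)
qed

section \<open>Independence of the current draw from the past, and the one-step average\<close>

text \<open>Iterate \<open>k\<close> and the draw of step \<open>k\<close> are functions of disjoint
  blocks of independent variables, so the expectation of the product factors. The weight
  \<open>h\<close> will be the indicator of one outcome of step \<open>k\<close>; its bound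
  \<open>C\<close> makes it integrable.\<close>

lemma expectation_fault_tolerant_iterate_independent:
  fixes g :: "'v::real_vector \<Rightarrow> real" and h :: "bool \<Rightarrow> nat \<Rightarrow> real"
  assumes process: "error_index_process M J \<theta> err idx" and J: "1 \<le> J"
    and bounded: "\<And>b i. \<bar>h b i\<bar> \<le> C"
  shows "(\<integral>\<omega>. h (err k \<omega>) (idx k \<omega>) * g (fault_tolerant_iterate A Q R f u0 err idx k \<omega>) \<partial>M)
    = (\<integral>\<omega>. h (err k \<omega>) (idx k \<omega>) \<partial>M) * (\<integral>\<omega>. g (fault_tolerant_iterate A Q R f u0 err idx k \<omega>) \<partial>M)"
proof -
  interpret prob_space M
    using process by (simp add: error_index_process_def)
  have [measurable]: "err k \<in> measurable M (count_space UNIV)" "idx k \<in> measurable M (count_space UNIV)"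
    using process by (simp_all add: error_index_process_def)
  \<comment> \<open>\<open>Inl\<close> tags error bits, stored as 0 or 1 and decoded below by
    comparison with 1; \<open>Inr\<close> tags indices. \<open>K\<close> is the past of step
    \<open>k\<close> and \<open>L\<close> its two own variables.\<close>
  define X where "X = case_sum (\<lambda>k \<omega>. of_bool (err k \<omega>) :: nat) idx"
  define K where "K = Inl ` {..<k} \<union> Inr ` {..<k}"
  define L where "L = {Inl k, Inr k :: nat + nat}"
  have X: "indep_vars (\<lambda>_. count_space UNIV) X UNIV"
    using process by (simp add: error_index_process_def X_def)
  have indep: "indep_var (PiM L (\<lambda>_. count_space UNIV)) (\<lambda>\<omega>. restrict (\<lambda>i. X i \<omega>) L)
      (PiM K (\<lambda>_. count_space UNIV)) (\<lambda>\<omega>. restrict (\<lambda>i. X i \<omega>) K)"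
    by (rule indep_var_restrict[OF X]) (auto simp: K_def L_def)
  \<comment> \<open>Running the iteration with the coordinate projections as the random draws exhibits it as a
    measurable function of the draws before step \<open>k\<close>.\<close>
  define G where "G y = g (fault_tolerant_iterate A Q R f u0
    (\<lambda>j y. y (Inl j) = (1::nat)) (\<lambda>j y. y (Inr j)) k y)" for y
  define H where "H y = h (y (Inl k) = (1::nat)) (y (Inr k))" for y :: "nat + nat \<Rightarrow> nat"
  have G: "G \<in> borel_measurable (PiM K (\<lambda>_. count_space UNIV))"
    unfolding G_def
  proof (rule measurable_compose[OF measurable_fault_tolerant_iterate, where g=g])
    fix j assume "j < k"
    then have [measurable]: "(\<lambda>y. y (Inl j)) \<in> measurable (PiM K (\<lambda>_. count_space UNIV)) (count_space UNIV)"
        "(\<lambda>y. y (Inr j)) \<in> measurable (PiM K (\<lambda>_. count_space UNIV)) (count_space (UNIV :: nat set))"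
      by (auto simp: K_def intro!: measurable_component_singleton)
    show "(\<lambda>y. y (Inl j) = (1::nat)) \<in> measurable (PiM K (\<lambda>_. count_space UNIV)) (count_space UNIV)"
      "(\<lambda>y. y (Inr j)) \<in> measurable (PiM K (\<lambda>_. count_space UNIV)) (count_space (UNIV :: nat set))"
      by measurable
  qed simp
  have H: "H \<in> borel_measurable (PiM L (\<lambda>_. count_space UNIV))"
  proof -
    have [measurable]: "(\<lambda>y. y (Inl k)) \<in> measurable (PiM L (\<lambda>_. count_space UNIV)) (count_space (UNIV :: nat set))"
        "(\<lambda>y. y (Inr k)) \<in> measurable (PiM L (\<lambda>_. count_space UNIV)) (count_space (UNIV :: nat set))"
      by (auto simp: L_def intro!: measurable_component_singleton)
    show ?thesis
      unfolding H_def by measurable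
  qed
  have H_eq: "H (restrict (\<lambda>i. X i \<omega>) L) = h (err k \<omega>) (idx k \<omega>)" for \<omega>
    by (simp add: H_def X_def L_def)
  have G_eq: "G (restrict (\<lambda>i. X i \<omega>) K) = g (fault_tolerant_iterate A Q R f u0 err idx k \<omega>)" for \<omega>
    unfolding G_def by (intro arg_cong[where f=g] fault_tolerant_iterate_cong) (auto simp: X_def K_def)
  have "indep_var borel (H \<circ> (\<lambda>\<omega>. restrict (\<lambda>i. X i \<omega>) L)) borel (G \<circ> (\<lambda>\<omega>. restrict (\<lambda>i. X i \<omega>) K))"
    by (rule indep_var_compose[OF indep H G])
  then have "indep_var borel (\<lambda>\<omega>. h (err k \<omega>) (idx k \<omega>))
      borel (\<lambda>\<omega>. g (fault_tolerant_iterate A Q R f u0 err idx k \<omega>))"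
    by (simp add: comp_def H_eq G_eq)
  moreover have "integrable M (\<lambda>\<omega>. h (err k \<omega>) (idx k \<omega>))"
    by (rule integrable_const_bound[where B=C]) (use bounded in auto)
  ultimately show ?thesis
    by (intro indep_var_lebesgue_integral integrable_fault_tolerant_iterate[OF process J])
qed

lemma expectation_error_index:
  assumes process: "error_index_process M J \<theta> err idx"
  shows "(\<integral>\<omega>. of_bool (err k \<omega>) \<partial>M) = \<theta>"
    and "i \<in> {1..J} \<Longrightarrow> (\<integral>\<omega>. of_bool (\<not> err k \<omega> \<and> idx k \<omega> = i) \<partial>M) = (1 - \<theta>) / real J"
proof -
  interpret prob_space M
    using process by (simp add: error_index_process_def)
  have [measurable]: "err k \<in> measurable M (count_space UNIV)" "idx k \<in> measurable M (count_space UNIV)"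
    using process by (simp_all add: error_index_process_def)
  have prob: "(\<integral>\<omega>. of_bool (Y \<omega>) \<partial>M) = prob {\<omega> \<in> space M. Y \<omega>}"
    if [measurable]: "Measurable.pred M Y" for Y
  proof -
    have "(\<integral>\<omega>. of_bool (Y \<omega>) \<partial>M) = (\<integral>\<omega>. indicator {\<omega> \<in> space M. Y \<omega>} \<omega> \<partial>M)"
      by (rule Bochner_Integration.integral_cong) (auto simp: indicator_def)
    also have "\<dots> = prob ({\<omega> \<in> space M. Y \<omega>} \<inter> space M)"
      by (rule Bochner_Integration.integral_indicator)
    finally show ?thesis
      by (simp add: Int_absorb2)
  qed
  show err: "(\<integral>\<omega>. of_bool (err k \<omega>) \<partial>M) = \<theta>"
    using process by (simp add: prob error_index_process_def)
  assume i: "i \<in> {1..J}"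
  let ?X = "case_sum (\<lambda>k \<omega>. of_bool (err k \<omega>) :: nat) idx"
  \<comment> \<open>The value 0 at \<open>Inl\<close> encodes the absence of an error.\<close>
  let ?B = "case_sum (\<lambda>_. {0}) (\<lambda>_. {i}) :: nat + nat \<Rightarrow> nat set"
  have "prob (\<Inter>x\<in>{Inl k, Inr k}. ?X x -` ?B x \<inter> space M)
      = (\<Prod>x\<in>{Inl k, Inr k}. prob (?X x -` ?B x \<inter> space M))"
    by (rule indep_varsD[where I=UNIV and M'="\<lambda>_. count_space UNIV"])
       (use process in \<open>simp_all add: error_index_process_def\<close>)
  moreover have "(\<Inter>x\<in>{Inl k, Inr k}. ?X x -` ?B x \<inter> space M) = {\<omega> \<in> space M. \<not> err k \<omega> \<and> idx k \<omega> = i}"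
    "?X (Inl k) -` ?B (Inl k) \<inter> space M = {\<omega> \<in> space M. \<not> err k \<omega>}"
    "?X (Inr k) -` ?B (Inr k) \<inter> space M = {\<omega> \<in> space M. idx k \<omega> = i}"
    by auto
  ultimately have "prob {\<omega> \<in> space M. \<not> err k \<omega> \<and> idx k \<omega> = i}
      = prob {\<omega> \<in> space M. \<not> err k \<omega>} * prob {\<omega> \<in> space M. idx k \<omega> = i}"
    by simp
  also have "prob {\<omega> \<in> space M. \<not> err k \<omega>} = 1 - \<theta>"
    using process by (subst prob_neg) (simp_all add: error_index_process_def)
  also have "prob {\<omega> \<in> space M. idx k \<omega> = i} = 1 / real J"
    using process i by (simp add: error_index_process_def)
  also have "prob {\<omega> \<in> space M. \<not> err k \<omega> \<and> idx k \<omega> = i} = (\<integral>\<omega>. of_bool (\<not> err k \<omega> \<and> idx k \<omega> = i) \<partial>M)"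
    by (subst prob) simp_all
  finally show "(\<integral>\<omega>. of_bool (\<not> err k \<omega> \<and> idx k \<omega> = i) \<partial>M) = (1 - \<theta>) / real J"
    by simp
qed

text \<open>Step \<open>k\<close> has \<open>J + 1\<close> outcomes: an error, or no error together
  with index \<open>i\<close>. Weighting by their indicators replaces conditioning, and each
  weighted expectation factors by independence.\<close>

lemma expectation_fault_tolerant_iterate_Suc:
  fixes g :: "'v::real_vector \<Rightarrow> real"
    and A :: "'v \<Rightarrow> 'v" and Q R :: "nat \<Rightarrow> 'v \<Rightarrow> 'v" and f u0 :: 'v
  assumes process: "error_index_process M J \<theta> err idx" and J: "1 \<le> J"
  defines "U \<equiv> fault_tolerant_iterate A Q R f u0 err idx"
  shows "(\<integral>\<omega>. g (U (Suc k) \<omega>) \<partial>M) = \<theta> * (\<integral>\<omega>. g (U k \<omega>) \<partial>M)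
    + (1 - \<theta>) / real J * (\<Sum>i=1..J. \<integral>\<omega>. g (U k \<omega> + R i (Q i (f - A (U k \<omega>)))) \<partial>M)"
proof -
  interpret prob_space M
    using process by (simp add: error_index_process_def)
  have [measurable]: "err k \<in> measurable M (count_space UNIV)" "idx k \<in> measurable M (count_space UNIV)"
    using process by (simp_all add: error_index_process_def)
  have integrable: "integrable M (\<lambda>\<omega>. g' (U k \<omega>))" for g' :: "'v \<Rightarrow> real" and k
    unfolding U_def by (rule integrable_fault_tolerant_iterate[OF process J])
  define g' where "g' i v = g (v + R i (Q i (f - A v)))" for i v
  have integrable_mult: "integrable M (\<lambda>\<omega>. of_bool (Y \<omega>) * g'' (U k \<omega>))"
    if [measurable]: "Measurable.pred M Y" for Y and g'' :: "'v \<Rightarrow> real"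
  proof (rule Bochner_Integration.integrable_bound[OF integrable[of g'' k]])
    have [measurable]: "(\<lambda>\<omega>. g'' (U k \<omega>)) \<in> borel_measurable M"
      using integrable by (rule borel_measurable_integrable)
    show "(\<lambda>\<omega>. of_bool (Y \<omega>) * g'' (U k \<omega>)) \<in> borel_measurable M"
      by measurable
  qed auto
  have int: "integrable M (\<lambda>\<omega>. of_bool (err k \<omega>) * g (U k \<omega>))"
    "integrable M (\<lambda>\<omega>. of_bool (\<not> err k \<omega> \<and> idx k \<omega> = i) * g' i (U k \<omega>))" for i
    by (intro integrable_mult; measurable)+
  \<comment> \<open>Exactly one indicator equals 1 once the index lies in \<open>{1..J}\<close>,
    hence almost everywhere.\<close>
  have "AE \<omega> in M. g (U (Suc k) \<omega>) = of_bool (err k \<omega>) * g (U k \<omega>)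
      + (\<Sum>i=1..J. of_bool (\<not> err k \<omega> \<and> idx k \<omega> = i) * g' i (U k \<omega>))"
    using AE_index_in_range[OF process J, of k]
  proof eventually_elim
    case (elim \<omega>)
    have "(\<Sum>i=1..J. of_bool (\<not> err k \<omega> \<and> idx k \<omega> = i) * g' i (U k \<omega>))
        = (\<Sum>i=1..J. if idx k \<omega> = i then of_bool (\<not> err k \<omega>) * g' i (U k \<omega>) else 0)"
      by (rule sum.cong) auto
    with elim show ?case
      by (simp add: g'_def U_def Let_def sum.delta')
  qed
  moreover have "(\<lambda>\<omega>. of_bool (err k \<omega>) * g (U k \<omega>)
      + (\<Sum>i=1..J. of_bool (\<not> err k \<omega> \<and> idx k \<omega> = i) * g' i (U k \<omega>))) \<in> borel_measurable M"
    by (intro borel_measurable_integrable Bochner_Integration.integrable_add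
        Bochner_Integration.integrable_sum integrable_mult) measurable
  ultimately have "(\<integral>\<omega>. g (U (Suc k) \<omega>) \<partial>M) = (\<integral>\<omega>. of_bool (err k \<omega>) * g (U k \<omega>)
      + (\<Sum>i=1..J. of_bool (\<not> err k \<omega> \<and> idx k \<omega> = i) * g' i (U k \<omega>)) \<partial>M)"
    using borel_measurable_integrable[OF integrable[of g "Suc k"]] by (intro integral_cong_AE)
  also have "\<dots> = (\<integral>\<omega>. of_bool (err k \<omega>) * g (U k \<omega>) \<partial>M)
      + (\<Sum>i=1..J. \<integral>\<omega>. of_bool (\<not> err k \<omega> \<and> idx k \<omega> = i) * g' i (U k \<omega>) \<partial>M)"
    \<comment> \<open>The deleted simp rule would absorb the indicator into a summation range
      depending on \<open>\<omega>\<close>, blocking the exchange of sum and integral.\<close>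
    by (subst Bochner_Integration.integral_add)
       (use int in \<open>auto intro!: Bochner_Integration.integral_sum Bochner_Integration.integrable_sum
          simp del: sum_of_bool_mult_eq\<close>)
  also have "(\<integral>\<omega>. of_bool (err k \<omega>) * g (U k \<omega>) \<partial>M) = \<theta> * (\<integral>\<omega>. g (U k \<omega>) \<partial>M)"
    using expectation_fault_tolerant_iterate_independent[OF process J,
        where h="\<lambda>b _. of_bool b" and C=1 and k=k and g=g and A=A and Q=Q and R=R and f=f and ?u0.0=u0]
    by (simp add: expectation_error_index[OF process] U_def)
  also have "(\<Sum>i=1..J. \<integral>\<omega>. of_bool (\<not> err k \<omega> \<and> idx k \<omega> = i) * g' i (U k \<omega>) \<partial>M)
      = (\<Sum>i=1..J. (1 - \<theta>) / real J * (\<integral>\<omega>. g' i (U k \<omega>) \<partial>M))"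
  proof (rule sum.cong[OF refl])
    fix i assume "i \<in> {1..J}"
    then show "(\<integral>\<omega>. of_bool (\<not> err k \<omega> \<and> idx k \<omega> = i) * g' i (U k \<omega>) \<partial>M)
      = (1 - \<theta>) / real J * (\<integral>\<omega>. g' i (U k \<omega>) \<partial>M)"
      using expectation_fault_tolerant_iterate_independent[OF process J,
        where h="\<lambda>b j. of_bool (\<not> b \<and> j = i)" and C=1 and k=k and g="g' i" and A=A and Q=Q and R=R
          and f=f and ?u0.0=u0]
      by (simp only: expectation_error_index(2)[OF process] U_def) simp
  qed
  finally show ?thesis
    by (simp add: g'_def sum_distrib_left)
qed

section \<open>The recursion, the product formula and the bounds on the rate\<close>

text \<open>Both bounds stand under the contraction hypothesis because positivity can fail without
  it: with \<open>J = 1\<close>, the whole space as only subspace, \<open>A\<close> the identity and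
  \<open>R 1\<close> three times the identity, \<open>\<delta> 0 = 1 - 4 = -3\<close> for
  \<open>u0 \<noteq> u\<close>. With \<open>R 1\<close> the identity instead, \<open>T 1\<close> is
  the identity and \<open>\<delta> 0 = 1 = J\<close>, so strictness comes with an exact
  characterization.\<close>

theorem theorem5:
  fixes A :: "'v::{real_inner, complete_space} \<Rightarrow> 'v"
    and J :: nat
    and V :: "nat \<Rightarrow> 'v set"
    and Q P As R Rt T :: "nat \<Rightarrow> 'v \<Rightarrow> 'v"
    and B\<^sub>a :: "'v \<Rightarrow> 'v"
    and f u u0 :: 'v
    and M :: "'w measure"
    and \<theta> :: real
    and err :: "nat \<Rightarrow> 'w \<Rightarrow> bool"
    and idx :: "nat \<Rightarrow> 'w \<Rightarrow> nat"
    and U e :: "nat \<Rightarrow> 'w \<Rightarrow> 'v"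
    and \<delta> :: "nat \<Rightarrow> real"
  assumes A: "spd_operator A"
    and u: "A u = f"
    and J: "1 \<le> J"
    and V: "\<And>i. i \<in> {1..J} \<Longrightarrow> subspace (V i)"
    and decomposition: "\<And>v. \<exists>w. (\<forall>i\<in>{1..J}. w i \<in> V i) \<and> v = (\<Sum>i=1..J. w i)"
    and Q: "\<And>i. i \<in> {1..J} \<Longrightarrow> projection_operator_on (\<bullet>) (V i) (Q i)"
    and P: "\<And>i. i \<in> {1..J} \<Longrightarrow> projection_operator_on (energy_inner A) (V i) (P i)"
    and As: "\<And>i. i \<in> {1..J} \<Longrightarrow> restricted_operator_on A (V i) (As i)"
    and R: "\<And>i. i \<in> {1..J} \<Longrightarrow> nonsingular_operator_on (V i) (R i)"
    and Rt: "\<And>i. i \<in> {1..J} \<Longrightarrow> adjoint_operator_on (V i) (R i) (Rt i)"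
    and T: "T = subspace_solver A Q R"
    and B\<^sub>a: "B\<^sub>a = parallel_correction J As Q R Rt"
    and \<theta>: "0 \<le> \<theta>" "\<theta> < 1"
    and process: "error_index_process M J \<theta> err idx"
    and U: "U = fault_tolerant_iterate A Q R f u0 err idx"
    and e: "\<And>k \<omega>. e k \<omega> = u - U k \<omega>"
    and \<delta>: "\<And>k. \<delta> k = (\<integral>\<omega>. energy_inner A (B\<^sub>a (A (e k \<omega>))) (e k \<omega>) \<partial>M)
                       / (\<integral>\<omega>. energy_inner A (e k \<omega>) (e k \<omega>) \<partial>M)"
  shows "\<forall>k.
      (\<integral>\<omega>. (energy_norm A (u - U (Suc k) \<omega>))\<^sup>2 \<partial>M)
        = (1 - (1 - \<theta>) * \<delta> k / real J) * (\<integral>\<omega>. (energy_norm A (u - U k \<omega>))\<^sup>2 \<partial>M)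
    \<and> (\<integral>\<omega>. (energy_norm A (u - U (Suc k) \<omega>))\<^sup>2 \<partial>M)
        = (\<Prod>l=0..k. 1 - (1 - \<theta>) * \<delta> l / real J) * (energy_norm A (u - u0))\<^sup>2
    \<and> ((\<integral>\<omega>. (energy_norm A (e k \<omega>))\<^sup>2 \<partial>M) \<noteq> 0
        \<and> (\<forall>i\<in>{1..J}. energy_opnorm A (V i) (\<lambda>v. v - T i v) < 1)
        \<longrightarrow> 0 < \<delta> k \<and> \<delta> k \<le> real J
          \<and> (\<delta> k < real J \<longleftrightarrow> \<not> (\<forall>i\<in>{1..J}. AE \<omega> in M. T i (e k \<omega>) = e k \<omega>)))"
proof -
  interpret prob_space M
    using process by (simp add: error_index_process_def)
  have lin: "linear A"
    using A by (simp add: spd_operator_def)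
  have R_lin: "linear_operator_on (V i) (R i)" if "i \<in> {1..J}" for i
    using R[OF that] by (simp add: nonsingular_operator_on_def)
  then have R_sub: "R i ` V i \<subseteq> V i" if "i \<in> {1..J}" for i
    using that by (simp add: linear_operator_on_def)
  define N where "N v = (energy_norm A v)\<^sup>2" for v
  define D where "D v = energy_inner A (B\<^sub>a (A v)) v" for v
  have N_nonneg: "0 \<le> N v" for v
    by (simp add: N_def)
  have N_0: "N v = 0 \<longleftrightarrow> v = 0" for v
    by (simp add: N_def energy_norm_eq_0_iff[OF A])
  have D_0: "D 0 = 0"
    by (simp add: D_def energy_inner_def)
  have D: "D v = (\<Sum>i=1..J. N v - N (v - T i v))" for v
  proof -
    have "D v = (\<Sum>i=1..J. energy_inner A (symmetrized_solver As R Rt i (Q i (A v))) v)"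
      by (simp add: D_def B\<^sub>a parallel_correction_def energy_inner_def linear_sum[OF lin] inner_sum_left)
    also have "\<dots> = (\<Sum>i=1..J. N v - N (v - T i v))"
      unfolding N_def T
      by (intro sum.cong energy_inner_symmetrized_solver[OF A Q As R_sub Rt]) simp_all
    finally show ?thesis .
  qed
  have integrable: "integrable M (\<lambda>\<omega>. g (e k \<omega>))" for g :: "'v \<Rightarrow> real" and k
    unfolding e U by (rule integrable_fault_tolerant_iterate[OF process J])
  have E_D: "(\<integral>\<omega>. D (e k \<omega>) \<partial>M)
      = real J * (\<integral>\<omega>. N (e k \<omega>) \<partial>M) - (\<Sum>i=1..J. \<integral>\<omega>. N (e k \<omega> - T i (e k \<omega>)) \<partial>M)" for k
    using integrable[of N k] integrable[of "\<lambda>v. N (v - T _ v)" k]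
    by (simp add: D sum_subtractf)
  have E_0: "AE \<omega> in M. e k \<omega> = 0" if "(\<integral>\<omega>. N (e k \<omega>) \<partial>M) = 0" for k
    using that integral_nonneg_eq_0_iff_AE[OF integrable[of N k]] by (simp add: N_nonneg N_0)
  \<comment> \<open>If the denominator is 0, the quotient is 0 by convention, while the error
    vanishes almost surely and so does the numerator. The recursion thus holds for every
    \<open>k\<close>.\<close>
  have \<delta>': "\<delta> k * (\<integral>\<omega>. N (e k \<omega>) \<partial>M) = (\<integral>\<omega>. D (e k \<omega>) \<partial>M)" for k
  proof (cases "(\<integral>\<omega>. N (e k \<omega>) \<partial>M) = 0")
    case True
    have "(\<integral>\<omega>. D (e k \<omega>) \<partial>M) = (\<integral>\<omega>. 0 \<partial>M)"
    proof (rule integral_cong_AE)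
      show "AE \<omega> in M. D (e k \<omega>) = 0"
        using E_0[OF True] by eventually_elim (simp add: D_0)
    qed (use integrable[of D k] in auto)
    with True show ?thesis by simp
  next
    case False
    then show ?thesis
      by (simp add: \<delta> D_def N_def energy_norm_power2[OF A])
  qed
  have correction: "u - (U k \<omega> + R i (Q i (f - A (U k \<omega>)))) = e k \<omega> - T i (e k \<omega>)" for i k \<omega>
    by (simp add: e T subspace_solver_def u[symmetric] linear_diff[OF lin])
  have step: "(\<integral>\<omega>. N (e (Suc k) \<omega>) \<partial>M) = (1 - (1 - \<theta>) * \<delta> k / real J) * (\<integral>\<omega>. N (e k \<omega>) \<partial>M)" for k
  proof -
    have "(\<integral>\<omega>. N (e (Suc k) \<omega>) \<partial>M) = \<theta> * (\<integral>\<omega>. N (e k \<omega>) \<partial>M)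
        + (1 - \<theta>) / real J * (\<Sum>i=1..J. \<integral>\<omega>. N (e k \<omega> - T i (e k \<omega>)) \<partial>M)"
      using expectation_fault_tolerant_iterate_Suc[OF process J, of "\<lambda>v. N (u - v)" A Q R f u0 k,
          folded U]
      unfolding correction by (simp only: e)
    \<comment> \<open>The sum of corrected energies is \<open>J\<close> times the current energy
      minus the expectation of \<open>D\<close>. After that substitution the weights
      \<open>\<theta>\<close> and \<open>1 - \<theta>\<close> of the current energy add up to
      1.\<close>
    also have "\<dots> = \<theta> * (\<integral>\<omega>. N (e k \<omega>) \<partial>M)
        + (1 - \<theta>) / real J * (real J * (\<integral>\<omega>. N (e k \<omega>) \<partial>M) - \<delta> k * (\<integral>\<omega>. N (e k \<omega>) \<partial>M))"
      unfolding \<delta>' E_D by simp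
    finally show ?thesis
      using J by (simp add: field_simps)
  qed
  have product: "(\<integral>\<omega>. N (e (Suc k) \<omega>) \<partial>M)
      = (\<Prod>l=0..k. 1 - (1 - \<theta>) * \<delta> l / real J) * N (u - u0)" for k
  proof (induction k)
    \<comment> \<open>The product up to \<open>k\<close> belongs to iterate \<open>Suc k\<close>, so
      the base case already takes one step from the deterministic initial error.\<close>
    case 0
    have "(\<integral>\<omega>. N (e 0 \<omega>) \<partial>M) = N (u - u0)"
      by (simp add: e U prob_space)
    then show ?case
      by (simp add: step)
  next
    case (Suc k)
    then show ?case
      by (simp add: step[of "Suc k"])
  qed
  have rate: "0 < \<delta> k \<and> \<delta> k \<le> real J
      \<and> (\<delta> k < real J \<longleftrightarrow> \<not> (\<forall>i\<in>{1..J}. AE \<omega> in M. T i (e k \<omega>) = e k \<omega>))"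
    if nz: "(\<integral>\<omega>. N (e k \<omega>) \<partial>M) \<noteq> 0"
      and contraction: "\<forall>i\<in>{1..J}. energy_opnorm A (V i) (\<lambda>v. v - T i v) < 1" for k
  proof -
    have pos: "0 < (\<integral>\<omega>. N (e k \<omega>) \<partial>M)"
      using nz by (simp add: less_le N_nonneg)
    have le: "N (v - T i v) \<le> N v" if "i \<in> {1..J}" for i v
      unfolding N_def T using contraction that
      by (intro energy_norm_subspace_correction_le[OF A V Q P R_lin]) (simp_all add: T)
    have less: "N (v - T i v) < N v" if "i \<in> {1..J}" "P i v \<noteq> 0" for i v
      unfolding N_def T using contraction that
      by (intro energy_norm_subspace_correction_less[OF A V Q P R_sub]) (simp_all add: T)
    have D_nonneg: "0 \<le> D v" for v
      unfolding D by (intro sum_nonneg) (simp add: le)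
    have D_eq_0: "v = 0" if "D v = 0" for v
    proof (rule energy_projections_eq_0[where A=A and V=V and P=P and I="{1..J}"])
      fix i assume i: "i \<in> {1..J}"
      have "N v - N (v - T i v) = 0"
        using that[unfolded D] i by (subst (asm) sum_nonneg_eq_0_iff) (auto simp: le)
      with less[OF i, of v] show "P i v = 0"
        by force
    qed (use A decomposition P in auto)
    \<comment> \<open>\<open>D\<close> is nonnegative and vanishes only at 0, so a zero expectation
      would force the error to vanish almost surely.\<close>
    have "(\<integral>\<omega>. D (e k \<omega>) \<partial>M) \<noteq> 0"
    proof
      assume "(\<integral>\<omega>. D (e k \<omega>) \<partial>M) = 0"
      then have "AE \<omega> in M. D (e k \<omega>) = 0"
        using integral_nonneg_eq_0_iff_AE[OF integrable[of D k]] by (simp add: D_nonneg)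
      then have "AE \<omega> in M. N (e k \<omega>) = 0"
        by eventually_elim (simp add: N_0 D_eq_0)
      then show False
        using nz integral_nonneg_eq_0_iff_AE[OF integrable[of N k]] by (simp add: N_nonneg)
    qed
    then have "0 < (\<integral>\<omega>. D (e k \<omega>) \<partial>M)"
      by (simp add: less_le D_nonneg)
    then have "0 < \<delta> k"
      using pos \<delta>'[of k] by (metis zero_less_mult_pos2)
    \<comment> \<open>The gap \<open>real J - \<delta> k\<close>, scaled by the expected energy, is
      a sum of expected squared norms. It is therefore nonnegative, and it vanishes exactly when
      every local correction removes the whole error almost surely.\<close>
    moreover define s where "s = (\<Sum>i=1..J. \<integral>\<omega>. N (e k \<omega> - T i (e k \<omega>)) \<partial>M)"
    have s: "(real J - \<delta> k) * (\<integral>\<omega>. N (e k \<omega>) \<partial>M) = s"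
      using \<delta>'[of k] E_D[of k] by (simp add: s_def algebra_simps)
    have s_nonneg: "0 \<le> s"
      unfolding s_def by (intro sum_nonneg) (simp add: N_nonneg)
    then have "\<delta> k \<le> real J"
      using s pos by (metis diff_ge_0_iff_ge mult_neg_pos not_le)
    moreover have "s = 0 \<longleftrightarrow> (\<forall>i\<in>{1..J}. AE \<omega> in M. T i (e k \<omega>) = e k \<omega>)"
    proof -
      have "s = 0 \<longleftrightarrow> (\<forall>i\<in>{1..J}. (\<integral>\<omega>. N (e k \<omega> - T i (e k \<omega>)) \<partial>M) = 0)"
        unfolding s_def by (subst sum_nonneg_eq_0_iff) (auto simp: N_nonneg)
      also have "\<dots> \<longleftrightarrow> (\<forall>i\<in>{1..J}. AE \<omega> in M. T i (e k \<omega>) = e k \<omega>)"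
      proof (intro ball_cong refl)
        fix i
        have "(\<integral>\<omega>. N (e k \<omega> - T i (e k \<omega>)) \<partial>M) = 0 \<longleftrightarrow> (AE \<omega> in M. N (e k \<omega> - T i (e k \<omega>)) = 0)"
          by (rule integral_nonneg_eq_0_iff_AE[OF integrable]) (simp add: N_nonneg)
        also have "\<dots> \<longleftrightarrow> (AE \<omega> in M. T i (e k \<omega>) = e k \<omega>)"
          unfolding N_0 right_minus_eq by (simp only: eq_commute)
        finally show "(\<integral>\<omega>. N (e k \<omega> - T i (e k \<omega>)) \<partial>M) = 0 \<longleftrightarrow> (AE \<omega> in M. T i (e k \<omega>) = e k \<omega>)" .
      qed
      finally show ?thesis .
    qed
    moreover have "s = 0 \<longleftrightarrow> \<delta> k = real J"
      using s pos by auto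
    ultimately show ?thesis
      by linarith
  qed
  show ?thesis
    using step product rate by (simp add: N_def e)
qed

end
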